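(* Let $n \ge 1$ and let $d_0 = 0 < d_1 \le d_2 \le d_3 \le \dots \le d_n$ be integers such that for every integer $k$ with $1 \le k \le n$, \[ \sum_{i=k}^n \frac{1}{2^{d_i - d_{k-1}}} \ge 1. \] Then there exists a Gallai coloring of the complete graph $K_n$ on the vertex set $\{1, 2, \dots, n\}$ in which the color degree of vertex $i$ is $d(i) = d_i$ for every $1 \le i \le n$.
   Context: A Gallai coloring of the complete graph $K_n$ is an assignment of a color to each edge (with no restriction on the number of colors, and not necessarily proper) such that there is no rainbow (tricolored) triangle, i.e. no triangle whose three edges have three pairwise distinct colors. The color degree $d(i)$ of a vertex $i$ is the number of distinct colors appearing on the edges incident to $i$. *)

theory Defs
  imports Complex_Main "HOL-Library.Ramsey"
begin

(* The complete graph on a vertex set V has edge set nsets V 2, the set of two-element subsets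
   of V.  A coloring is a function on sets of vertices, of which only the values on nsets V 2
   are used. *)

definition gallai_coloring :: "'a set \<Rightarrow> ('a set \<Rightarrow> 'c) \<Rightarrow> bool" where
  "gallai_coloring V c \<longleftrightarrow>
     \<not> (\<exists>x\<in>V. \<exists>y\<in>V. \<exists>z\<in>V. distinct [x, y, z] \<and> distinct [c {x, y}, c {y, z}, c {x, z}])"

definition color_degree :: "'a set \<Rightarrow> ('a set \<Rightarrow> 'c) \<Rightarrow> 'a \<Rightarrow> nat" where
  "color_degree V c v = card (c ` {e \<in> nsets V 2. v \<in> e})"

end

theory Submission
  imports Defs
begin

text \<open>
  Say that the degrees \<open>d\<close> on \<open>V\<close> satisfy the tail condition if for every \<open>t\<close> that is \<open>0\<close> or one of
  the degrees, but not the largest one, the weights \<open>2\<^sup>-\<^sup>d\<^sup>(\<^sup>w\<^sup>)\<close> of the vertices with \<open>d(w) > t\<close> add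
  up to at least \<open>2\<^sup>-\<^sup>t\<close>.  Induct on the number of vertices.  Let \<open>D\<close> be the largest degree and
  \<open>m\<close> the number of vertices having it; the condition forces \<open>m \<ge> 2\<close>.  If \<open>D = 1\<close>, a single color
  suffices.  If \<open>m\<close> is even, two vertices of degree \<open>D\<close> are merged into one of degree \<open>D - 1\<close>,
  which preserves the tail sums; the merged vertex is then split into twins joined by a new color.
  If \<open>m\<close> is odd, one vertex of degree \<open>D\<close> is deleted: in units of \<open>2\<^sup>-\<^sup>D\<close> the tail sums are odd
  and their lower bounds even, so there is room to subtract one unit; the deleted vertex is then
  restored as a twin of another one of degree \<open>D\<close>, joined to it by a color already present there.
\<close>

text \<open>Indexing by the value \<open>t\<close> rather than by a position in a sorted list lets
  vertices be merged or deleted without reordering. Among tied degrees the strict tail is the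
  shortest one and so carries the strongest bound. Above the largest degree the tail is empty, hence
  the exemption.\<close>

definition tail_condition :: "'a set \<Rightarrow> ('a \<Rightarrow> nat) \<Rightarrow> bool" where
  "tail_condition V d \<longleftrightarrow> (\<forall>t\<in>insert 0 (d ` V). (\<exists>w\<in>V. t < d w) \<longrightarrow>
     (1/2::real) ^ t \<le> (\<Sum>w | w \<in> V \<and> t < d w. (1/2) ^ d w))"

section \<open>Color degrees and twin colorings\<close>

lemma color_degree_eq: "color_degree V c v = card ((\<lambda>w. c {v, w}) ` (V - {v}))"
  if "v \<in> V"
proof -
  have "{e \<in> nsets V 2. v \<in> e} = (\<lambda>w. {v, w}) ` (V - {v})"
    using that by (auto simp: nsets_def card_2_iff image_iff doubleton_eq_iff)
  then show ?thesis
    by (simp add: color_degree_def image_image)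
qed

text \<open>The map \<open>id(v := u)\<close> makes \<open>v\<close> a copy of \<open>u\<close>, but
  it would collapse \<open>{u, v}\<close> to a singleton. The color \<open>x\<close> of that edge is
  therefore a parameter: fresh when a merge is undone, already present at \<open>u\<close> when a
  deletion is undone.\<close>

definition twin_coloring :: "'a \<Rightarrow> 'a \<Rightarrow> 'c \<Rightarrow> ('a set \<Rightarrow> 'c) \<Rightarrow> 'a set \<Rightarrow> 'c" where
  "twin_coloring u v x c e = (if e = {u, v} then x else c (id(v := u) ` e))"

lemma twin_coloring_simps:
  assumes "u \<noteq> v"
  shows "twin_coloring u v x c {u, v} = x" "twin_coloring u v x c {v, u} = x"
    "w \<noteq> u \<Longrightarrow> w \<noteq> v \<Longrightarrow> twin_coloring u v x c {v, w} = c {u, w}"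
    "w \<noteq> u \<Longrightarrow> w \<noteq> v \<Longrightarrow> twin_coloring u v x c {w, v} = c {w, u}"
    "w \<noteq> v \<Longrightarrow> y \<noteq> v \<Longrightarrow> twin_coloring u v x c {w, y} = c {w, y}"
  using assms by (auto simp: twin_coloring_def insert_commute doubleton_eq_iff)

text \<open>A triangle through both twins has two edges of equal color, whatever \<open>x\<close>
  is; a triangle through \<open>v\<close> alone is a copy of one through \<open>u\<close>.\<close>

lemma gallai_twin_coloring:
  assumes "gallai_coloring V c" "u \<in> V" "v \<notin> V"
  shows "gallai_coloring (insert v V) (twin_coloring u v x c)"
proof -
  let ?c = "twin_coloring u v x c"
  have uv: "u \<noteq> v"
    using assms by auto
  have old: "\<not> distinct [c {a, b}, c {b, e}, c {a, e}]"
    if "a \<in> V" "b \<in> V" "e \<in> V" "distinct [a, b, e]" for a b e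
    using assms(1) that unfolding gallai_coloring_def by blast
  have new: "\<not> distinct [?c {v, b}, ?c {b, e}, ?c {v, e}]"
    if "b \<in> V" "e \<in> V" "b \<noteq> e" for b e
  proof -
    have "b \<noteq> v" "e \<noteq> v"
      using that assms(3) by auto
    then show ?thesis
      using uv that old[of u b e] assms(2)
      by (cases "b = u"; cases "e = u") (simp_all add: twin_coloring_simps insert_commute)
  qed
  show ?thesis
    unfolding gallai_coloring_def
  proof (intro notI, elim bexE conjE)
    fix a b e
    assume in_V: "a \<in> insert v V" "b \<in> insert v V" "e \<in> insert v V"
      and dist: "distinct [a, b, e]" and rainbow: "distinct [?c {a, b}, ?c {b, e}, ?c {a, e}]"
    consider "a = v" | "b = v" | "e = v" | "a \<noteq> v" "b \<noteq> v" "e \<noteq> v"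
      by blast
    then show False
    proof cases
      case 1
      then show False
        using new[of b e] in_V dist rainbow by auto
    next
      case 2
      then show False
        using new[of a e] in_V dist rainbow by (auto simp: insert_commute)
    next
      case 3
      then show False
        using new[of a b] in_V dist rainbow by (auto simp: insert_commute)
    next
      case 4
      then show False
        using old[of a b e] in_V dist rainbow uv by (simp add: twin_coloring_simps)
    qed
  qed
qed

text \<open>The additional edge from \<open>w\<close> to \<open>v\<close> only repeats the color of
  the edge from \<open>w\<close> to \<open>u\<close>.\<close>

lemma color_degree_twin_coloring_other:
  assumes "u \<in> V" "v \<notin> V" "w \<in> V" "w \<noteq> u"
  shows "color_degree (insert v V) (twin_coloring u v x c) w = color_degree V c w"
proof -
  have ne: "y \<noteq> v" if "y \<in> V" for y
    using that assms(2) by auto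
  then have "u \<noteq> v" "w \<noteq> v"
    using assms by auto
  have "(\<lambda>y. twin_coloring u v x c {w, y}) ` (V - {w}) = (\<lambda>y. c {w, y}) ` (V - {w})"
    using \<open>u \<noteq> v\<close> \<open>w \<noteq> v\<close> ne by (intro image_cong) (simp_all add: twin_coloring_simps)
  moreover have "insert v V - {w} = insert v (V - {w})"
    using \<open>w \<noteq> v\<close> by auto
  ultimately have "(\<lambda>y. twin_coloring u v x c {w, y}) ` (insert v V - {w}) = (\<lambda>y. c {w, y}) ` (V - {w})"
    using assms \<open>u \<noteq> v\<close> by (auto simp: twin_coloring_simps)
  then show ?thesis
    using assms by (simp add: color_degree_eq)
qed

text \<open>Both twins see the old colors at \<open>u\<close> together with \<open>x\<close>, so the
  choice of \<open>x\<close> decides whether the degree grows by one or stays.\<close>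

lemma color_degree_twin_coloring_twin:
  assumes "u \<in> V" "v \<notin> V" "w = u \<or> w = v"
  shows "color_degree (insert v V) (twin_coloring u v x c) w
    = card (insert x ((\<lambda>y. c {u, y}) ` (V - {u})))"
proof -
  have ne: "y \<noteq> v" if "y \<in> V" for y
    using that assms(2) by auto
  then have "u \<noteq> v"
    using assms by auto
  have eq: "(\<lambda>y. twin_coloring u v x c {w, y}) ` (V - {u}) = (\<lambda>y. c {u, y}) ` (V - {u})"
    using assms(3) \<open>u \<noteq> v\<close> ne
    by (intro image_cong) (elim disjE; simp add: twin_coloring_simps)+
  have "insert v V - {w} = insert (if w = u then v else u) (V - {u})"
    using assms \<open>u \<noteq> v\<close> by auto
  moreover have "twin_coloring u v x c {w, if w = u then v else u} = x"
    using assms(3) \<open>u \<noteq> v\<close> by (auto simp: twin_coloring_simps)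
  ultimately have "(\<lambda>y. twin_coloring u v x c {w, y}) ` (insert v V - {w})
      = insert x ((\<lambda>y. c {u, y}) ` (V - {u}))"
    using eq by simp
  then show ?thesis
    using assms by (subst color_degree_eq) auto
qed

section \<open>Tail sums under merging and deletion\<close>

lemma tail_sum_split:
  fixes d :: "'a \<Rightarrow> nat"
  assumes "finite V" "t < D" "\<And>w. w \<in> V \<Longrightarrow> d w \<le> D"
  shows "(\<Sum>w | w \<in> V \<and> t < d w. (1/2::real) ^ d w)
    = (\<Sum>w | w \<in> V \<and> t < d w \<and> d w < D. (1/2) ^ d w) + card {w \<in> V. d w = D} * (1/2) ^ D"
proof -
  have "{w. w \<in> V \<and> t < d w} = {w. w \<in> V \<and> t < d w \<and> d w < D} \<union> {w \<in> V. d w = D}"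
    using assms(2,3) by (auto simp: order.order_iff_strict)
  moreover have "{w. w \<in> V \<and> t < d w \<and> d w < D} \<inter> {w \<in> V. d w = D} = {}"
    by auto
  ultimately show ?thesis
    using assms(1) by (simp add: sum.union_disjoint)
qed

text \<open>If only \<open>v\<close> had the largest degree, the tail above the next smaller degree
  (or 0) would be the single weight \<open>(1/2) ^ d v\<close>, which is too small.\<close>

lemma tail_condition_card_max:
  fixes d :: "'a \<Rightarrow> nat"
  assumes "finite V" "tail_condition V d" "v \<in> V" "0 < d v" "\<And>w. w \<in> V \<Longrightarrow> d w \<le> d v"
  shows "2 \<le> card {w \<in> V. d w = d v}"
proof (rule ccontr)
  assume "\<not> ?thesis"
  moreover have "card {w \<in> V. d w = d v} \<noteq> 0"
    using assms(1,3) by auto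
  ultimately have card: "card {w \<in> V. d w = d v} = 1"
    by linarith
  define t where "t = Max (insert 0 (d ` {w \<in> V. d w < d v}))"
  have fin: "finite (insert 0 (d ` {w \<in> V. d w < d v}))"
    using assms(1) by simp
  then have t: "t \<in> insert 0 (d ` {w \<in> V. d w < d v})"
    unfolding t_def by (rule Max_in) simp
  then have "t < d v"
    using assms(4) by auto
  have "d w \<le> t" if "w \<in> V" "d w < d v" for w
    unfolding t_def using fin that by (intro Max_ge) auto
  then have empty: "{w. w \<in> V \<and> t < d w \<and> d w < d v} = {}"
    by (auto simp: not_less)
  have "(\<Sum>w | w \<in> V \<and> t < d w. (1/2::real) ^ d w) = (1/2) ^ d v"
    using tail_sum_split[of V t "d v" d] assms(1,5) \<open>t < d v\<close> unfolding empty card by simp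
  moreover have "(1/2::real) ^ t \<le> (\<Sum>w | w \<in> V \<and> t < d w. (1/2) ^ d w)"
    using assms(2,3) t \<open>t < d v\<close> unfolding tail_condition_def by blast
  ultimately show False
    using power_strict_decreasing[OF \<open>t < d v\<close>, of "1/2::real"] by simp
qed

lemma tail_condition_merge:
  fixes d :: "'a \<Rightarrow> nat"
  assumes "finite V" "tail_condition V d" "u \<in> V" "v \<in> V" "u \<noteq> v" "d u = D" "d v = D"
    and "\<And>w. w \<in> V \<Longrightarrow> d w \<le> D" "1 < D" "even (card {w \<in> V. d w = D})"
  shows "tail_condition (V - {v}) (d(u := D - 1))"
  unfolding tail_condition_def
proof (intro ballI impI)
  let ?d = "d(u := D - 1)"
  fix t
  assume t: "t \<in> insert 0 (?d ` (V - {v}))" and ex: "\<exists>w\<in>V - {v}. t < ?d w"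
  have half: "(1/2::real) ^ (D - 1) = (1/2) ^ D + (1/2) ^ D"
    using assms(9) by (cases D) auto
  let ?R = "{w. w \<in> V \<and> t < d w} - {u, v}"
  have fin: "finite ?R"
    using assms(1) by simp
  have "t < D"
    using ex assms(8,9) by (force split: if_splits)
  then consider "t < D - 1" | "t = D - 1"
    by linarith
  then show "(1/2::real) ^ t \<le> (\<Sum>w | w \<in> V - {v} \<and> t < ?d w. (1/2) ^ ?d w)"
  proof cases
    \<comment> \<open>Here \<open>t\<close> is also a threshold for \<open>d\<close>, and the merged
      vertex carries exactly the two weights that it replaces.\<close>
    case 1
    have "t \<in> insert 0 (d ` V)"
      using t 1 by (auto split: if_splits)
    then have "(1/2::real) ^ t \<le> (\<Sum>w | w \<in> V \<and> t < d w. (1/2) ^ d w)"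
      using assms(2,3,6) \<open>t < D\<close> unfolding tail_condition_def by blast
    also have "{w. w \<in> V \<and> t < d w} = insert u (insert v ?R)"
      using assms(3,4,6,7) \<open>t < D\<close> by auto
    also have "(\<Sum>w\<in>insert u (insert v ?R). (1/2::real) ^ d w)
        = (1/2) ^ (D - 1) + (\<Sum>w\<in>?R. (1/2) ^ d w)"
      using assms(5,6,7) fin half by simp
    also have "\<dots> = (\<Sum>w\<in>insert u ?R. (1/2) ^ ?d w)"
      using fin by simp
    also have "insert u ?R = {w. w \<in> V - {v} \<and> t < ?d w}"
      using assms(3,5) 1 by auto
    finally show ?thesis .
  next
    \<comment> \<open>The threshold \<open>D - 1\<close> may be new, and the merged vertex is not
      above it. The remaining vertices of degree \<open>D\<close> are even in number and not zero,
      so two of their weights already reach the bound.\<close>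
    case 2
    let ?M = "{w \<in> V. d w = D}"
    have R: "?R = ?M - {u, v}" and tail: "{w. w \<in> V - {v} \<and> t < ?d w} = ?R"
      using assms(8) 2 \<open>t < D\<close> by (force simp: less_Suc_eq_le order.order_iff_strict)+
    have "card ?R = card ?M - 2"
      unfolding R using assms(3-7) by (subst card_Diff_subset) auto
    moreover have "card ?R \<noteq> 0"
      using ex fin unfolding tail[symmetric] by auto
    ultimately have "2 \<le> card ?R"
      using assms(10) by presburger
    have "(1/2::real) ^ t = 2 * (1/2) ^ D"
      using half 2 by simp
    also have "\<dots> \<le> card ?R * (1/2) ^ D"
      using \<open>2 \<le> card ?R\<close> by (intro mult_right_mono) auto
    also have "\<dots> = (\<Sum>w\<in>?R. (1/2) ^ D)"
      by simp
    also have "\<dots> = (\<Sum>w\<in>?R. (1/2) ^ ?d w)"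
      unfolding R by (intro sum.cong) auto
    finally show ?thesis
      unfolding tail .
  qed
qed

lemma tail_condition_delete:
  fixes d :: "'a \<Rightarrow> nat"
  assumes "finite V" "tail_condition V d" "v \<in> V" "d v = D"
    and "\<And>w. w \<in> V \<Longrightarrow> d w \<le> D" "odd (card {w \<in> V. d w = D})"
  shows "tail_condition (V - {v}) d"
  unfolding tail_condition_def
proof (intro ballI impI)
  fix t
  assume t: "t \<in> insert 0 (d ` (V - {v}))" and ex: "\<exists>w\<in>V - {v}. t < d w"
  let ?M = "card {w \<in> V. d w = D}" and ?L = "{w. w \<in> V \<and> t < d w \<and> d w < D}"
  let ?S = "\<lambda>A. \<Sum>w\<in>A. (1/2::real) ^ d w"
  \<comment> \<open>The tail sum in units of \<open>(1/2) ^ D\<close>. Vertices of degree below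
    \<open>D\<close> contribute even numbers, so its parity is that of \<open>?M\<close>.\<close>
  define N where "N = (\<Sum>w\<in>?L. 2 ^ (D - d w)) + ?M"
  have "t < D"
    using ex assms(5) by force
  have scale: "2 ^ D * (1/2::real) ^ k = real (2 ^ (D - k))" if "k \<le> D" for k
    using that power_diff[of "2::real" k D] by (simp add: power_divide)
  have "2 ^ D * ?S {w. w \<in> V \<and> t < d w} = 2 ^ D * ?S ?L + ?M * (2 ^ D * (1/2) ^ D)"
    using assms(5) by (simp add: tail_sum_split[OF assms(1) \<open>t < D\<close>] algebra_simps)
  also have "2 ^ D * ?S ?L = real (\<Sum>w\<in>?L. 2 ^ (D - d w))"
    unfolding sum_distrib_left of_nat_sum by (intro sum.cong refl scale) auto
  finally have N: "2 ^ D * ?S {w. w \<in> V \<and> t < d w} = real N"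
    using scale[of D] by (simp add: N_def)
  have "(1/2::real) ^ t \<le> ?S {w. w \<in> V \<and> t < d w}"
    using assms(2,3,4) t \<open>t < D\<close> unfolding tail_condition_def by blast
  then have "2 ^ D * (1/2::real) ^ t \<le> 2 ^ D * ?S {w. w \<in> V \<and> t < d w}"
    by (intro mult_left_mono) auto
  then have "2 ^ (D - t) \<le> N"
    unfolding N using scale[of t] \<open>t < D\<close> by linarith
  moreover have "even (2 ^ (D - t) :: nat)"
    using \<open>t < D\<close> by simp
  moreover have "odd N"
    using assms(6) by (auto simp: N_def intro!: dvd_sum)
  ultimately have "2 ^ (D - t) + 1 \<le> N"
    by (metis Suc_eq_plus1 le_neq_implies_less Suc_leI)
  then have "real (2 ^ (D - t)) + 1 \<le> real N"
    by linarith
  then have "2 ^ D * ((1/2::real) ^ t + (1/2) ^ D) \<le> 2 ^ D * ?S {w. w \<in> V \<and> t < d w}"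
    unfolding N using scale[of t] scale[of D] \<open>t < D\<close> by (simp add: distrib_left)
  then have "(1/2::real) ^ t + (1/2) ^ D \<le> ?S {w. w \<in> V \<and> t < d w}"
    by simp
  moreover have "?S {w. w \<in> V \<and> t < d w} = (1/2) ^ D + ?S ({w. w \<in> V \<and> t < d w} - {v})"
    using assms(1,3,4) \<open>t < D\<close> by (subst sum.remove[of _ v]) auto
  moreover have "{w. w \<in> V \<and> t < d w} - {v} = {w. w \<in> V - {v} \<and> t < d w}"
    by auto
  ultimately show "(1/2::real) ^ t \<le> ?S {w. w \<in> V - {v} \<and> t < d w}"
    by simp
qed

section \<open>The induction and the passage to sorted sequences\<close>

lemma tail_condition_imp_gallai_coloring:
  fixes d :: "'a \<Rightarrow> nat"
  assumes "finite V" "V \<noteq> {}" "\<And>w. w \<in> V \<Longrightarrow> 0 < d w" "tail_condition V d"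
  shows "\<exists>c :: 'a set \<Rightarrow> nat. gallai_coloring V c \<and> (\<forall>w\<in>V. color_degree V c w = d w)"
  using assms
proof (induction "card V" arbitrary: V d rule: less_induct)
  case less
  define D where "D = Max (d ` V)"
  have le_D: "d w \<le> D" if "w \<in> V" for w
    using less.prems(1) that by (simp add: D_def)
  have "D \<in> d ` V"
    unfolding D_def using less.prems by (intro Max_in) auto
  then obtain v where v: "v \<in> V" "d v = D"
    by auto
  \<comment> \<open>This rules out a single vertex, so no separate base case is needed, and it
    supplies the twin partner \<open>u\<close> for \<open>v\<close>.\<close>
  then have card: "2 \<le> card {w \<in> V. d w = D}"
    using tail_condition_card_max[of V d v] less.prems le_D by auto
  then have "\<not> {w \<in> V. d w = D} \<subseteq> {v}"
    using card_mono[of "{v}" "{w \<in> V. d w = D}"] by auto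
  then obtain u where u: "u \<in> V" "d u = D" "u \<noteq> v"
    by auto
  define W where "W = V - {v}"
  have W: "V = insert v W" "v \<notin> W" "u \<in> W" "finite W" "W \<noteq> {}" "card W < card V"
    using u v less.prems(1) card_Diff1_less[of V v] by (auto simp: W_def simp del: card_Diff_singleton)
  consider "D = 1" | "D > 1" "even (card {w \<in> V. d w = D})" | "odd (card {w \<in> V. d w = D})"
    using less.prems(3)[OF v(1)] v(2) by linarith
  then show ?case
  proof cases
    case 1
    have "color_degree V (\<lambda>_. 0::nat) w = d w" if "w \<in> V" for w
    proof -
      have "V - {w} \<noteq> {}"
        using u v by auto
      then have "(\<lambda>y. 0::nat) ` (V - {w}) = {0}"
        by auto
      moreover have "d w = 1"
        using 1 le_D[OF that] less.prems(3)[OF that] by simp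
      ultimately show ?thesis
        using that by (simp add: color_degree_eq)
    qed
    then show ?thesis
      by (intro exI[of _ "\<lambda>_. 0"]) (auto simp: gallai_coloring_def)
  next
    case 2
    let ?d = "d(u := D - 1)"
    have "tail_condition W ?d"
      unfolding W_def using less.prems u v le_D 2 by (intro tail_condition_merge) auto
    moreover have "0 < ?d w" if "w \<in> W" for w
      using that less.prems(3) 2(1) W(1) by auto
    ultimately obtain c :: "'a set \<Rightarrow> nat" where
      c: "gallai_coloring W c" "\<And>w. w \<in> W \<Longrightarrow> color_degree W c w = ?d w"
      using less.hyps[of W ?d] W by blast
    let ?C = "(\<lambda>y. c {u, y}) ` (W - {u})"
    have fin: "finite ?C"
      using W(4) by simp
    \<comment> \<open>The merged vertex \<open>u\<close> sees \<open>D - 1\<close> colors in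
      \<open>W\<close>; a fresh \<open>x\<close> raises both twins to \<open>D\<close>.\<close>
    then obtain x where x: "x \<notin> ?C"
      using ex_new_if_finite[OF infinite_UNIV_nat] by blast
    have "card (insert x ?C) = D"
      using x fin c(2)[OF W(3)] W(3) 2(1) by (simp add: color_degree_eq)
    then have "color_degree V (twin_coloring u v x c) w = d w" if "w \<in> V" for w
      using that c(2) W(1-3) u v
      by (cases "w = u \<or> w = v")
        (auto simp: color_degree_twin_coloring_twin color_degree_twin_coloring_other)
    then show ?thesis
      using gallai_twin_coloring[OF c(1) W(3) W(2)] W(1) by blast
  next
    case 3
    have "tail_condition W d"
      unfolding W_def using less.prems v le_D 3 by (intro tail_condition_delete) auto
    moreover have "0 < d w" if "w \<in> W" for w
      using that less.prems(3) W(1) by auto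
    ultimately obtain c :: "'a set \<Rightarrow> nat" where
      c: "gallai_coloring W c" "\<And>w. w \<in> W \<Longrightarrow> color_degree W c w = d w"
      using less.hyps[of W d] W by blast
    let ?C = "(\<lambda>y. c {u, y}) ` (W - {u})"
    have C: "card ?C = D"
      using c(2)[OF W(3)] W(3) u(2) by (simp add: color_degree_eq)
    moreover have "0 < D"
      using less.prems(3)[OF u(1)] u(2) by simp
    \<comment> \<open>Since \<open>D\<close> is positive, some color at \<open>u\<close> can be
      reused for the edge between the twins, leaving the degree at \<open>D\<close>.\<close>
    ultimately have "?C \<noteq> {}"
      by (metis card.empty less_irrefl)
    then obtain x where "x \<in> ?C"
      by blast
    then have "card (insert x ?C) = D"
      using C by (simp only: insert_absorb)
    then have "color_degree V (twin_coloring u v x c) w = d w" if "w \<in> V" for w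
      using that c(2) W(1-3) u v
      by (cases "w = u \<or> w = v")
        (auto simp: color_degree_twin_coloring_twin color_degree_twin_coloring_other)
    then show ?thesis
      using gallai_twin_coloring[OF c(1) W(3) W(2)] W(1) by blast
  qed
qed

theorem theorem1p4:
  fixes n :: nat and d :: "nat \<Rightarrow> int"
  assumes "n \<ge> 1"
    and "d 0 = 0" and "0 < d 1"
    and "\<And>i. 1 \<le> i \<Longrightarrow> i < n \<Longrightarrow> d i \<le> d (i + 1)"
    and "\<And>k. 1 \<le> k \<Longrightarrow> k \<le> n \<Longrightarrow>
           (\<Sum>i = k..n. 1 / (2::real) powi (d i - d (k - 1))) \<ge> 1"
  shows "\<exists>c :: nat set \<Rightarrow> nat. gallai_coloring {1..n} c \<and>
           (\<forall>i\<in>{1..n}. int (color_degree {1..n} c i) = d i)"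
proof -
  have step: "d i \<le> d (Suc i)" if "i < n" for i
    using assms(2-4) that by (cases i) fastforce+
  have mono: "d i \<le> d j" if "i \<le> j" "j \<le> n" for i j
    using that by (induction j rule: dec_induct) (auto intro: order.trans[OF _ step])
  have pos: "0 < d i" if "i \<in> {1..n}" for i
    using mono[of 1 i] assms(3) that by auto
  have nonneg: "0 \<le> d i" if "i \<le> n" for i
    using mono[of 0 i] assms(2) that by auto
  let ?e = "\<lambda>i. nat (d i)"
  have "tail_condition {1..n} ?e"
    unfolding tail_condition_def
  proof (intro ballI impI)
    fix t
    assume t: "t \<in> insert 0 (?e ` {1..n})" and ex: "\<exists>w\<in>{1..n}. t < ?e w"
    \<comment> \<open>Index 0 is included so that \<open>t = 0\<close> is covered. By monotonicity,
      the vertices of degree above \<open>t\<close> are those after the last index in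
      \<open>I\<close>, so the hypothesis is applied with \<open>k = Suc (Max I)\<close>.\<close>
    define I where "I = {i \<in> {0..n}. d i = int t}"
    have "finite I"
      by (simp add: I_def)
    moreover have "I \<noteq> {}"
      using t assms(2) nonneg by (fastforce simp: I_def)
    ultimately have "Max I \<in> I"
      by (rule Max_in)
    then have j: "d (Max I) = int t" "Max I \<le> n"
      by (auto simp: I_def)
    have tail: "{w. w \<in> {1..n} \<and> t < ?e w} = {Suc (Max I)..n}"
    proof (intro equalityI subsetI)
      fix w assume "w \<in> {w. w \<in> {1..n} \<and> t < ?e w}"
      then show "w \<in> {Suc (Max I)..n}"
        using mono[of w "Max I"] j by (auto simp: not_less_eq_eq[symmetric])
    next
      fix w assume w: "w \<in> {Suc (Max I)..n}"
      then have "w \<notin> I"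
        using Max_ge[OF \<open>finite I\<close>, of w] by force
      then have "d w \<noteq> int t"
        using w by (auto simp: I_def)
      then show "w \<in> {w. w \<in> {1..n} \<and> t < ?e w}"
        using w mono[of "Max I" w] j by auto
    qed
    \<comment> \<open>The existence of a degree above \<open>t\<close> ensures that this
      \<open>k\<close> is at most \<open>n\<close>.\<close>
    have "{Suc (Max I)..n} \<noteq> {}"
      using ex unfolding tail[symmetric] by blast
    then have "Suc (Max I) \<le> n"
      by simp
    then have "1 \<le> (\<Sum>i = Suc (Max I)..n. 1 / (2::real) powi (d i - int t))"
      using assms(5)[of "Suc (Max I)"] j by simp
    also have "\<dots> = (\<Sum>i = Suc (Max I)..n. 2 ^ t * (1/2) ^ ?e i)"
    proof (intro sum.cong refl)
      fix i assume "i \<in> {Suc (Max I)..n}"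
      then have "d i = int (?e i)"
        using nonneg by auto
      then have "(2::real) powi (d i - int t) = 2 ^ ?e i / 2 ^ t"
        by (metis power_int_diff power_int_of_nat zero_neq_numeral)
      then show "1 / (2::real) powi (d i - int t) = 2 ^ t * (1/2) ^ ?e i"
        by (simp add: power_divide)
    qed
    also have "\<dots> = 2 ^ t * (\<Sum>i = Suc (Max I)..n. (1/2) ^ ?e i)"
      by (simp add: sum_distrib_left)
    finally show "(1/2::real) ^ t \<le> (\<Sum>w | w \<in> {1..n} \<and> t < ?e w. (1/2) ^ ?e w)"
      unfolding tail by (simp add: power_divide field_simps)
  qed
  then obtain c :: "nat set \<Rightarrow> nat" where
    "gallai_coloring {1..n} c" "\<forall>i\<in>{1..n}. color_degree {1..n} c i = ?e i"
    using tail_condition_imp_gallai_coloring[of "{1..n}" ?e] pos assms(1) by auto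
  then show ?thesis
    using pos by (intro exI[of _ c]) (auto simp: order.strict_implies_order)
qed

end
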